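(* Let $A$ be an $n\times n$ real matrix and let $k\geq 1$ be an integer. Then the following statements hold: (1) If $k+2\leq n$ and $A$ is $TP_{k+2}$, then the Dodgson condensation matrix $D_k(A)$ is $TP_2$. (2) If $k+3\leq n$ and $A$ is $TP_{k+3}$, then the Dodgson condensation matrix $D_k(A)$ is $TP_3$.
   Context: A real $m\times n$ matrix is called $TP_r$, where $1\leq r\leq\min\{m,n\}$, if all of its minors (determinants of square submatrices, with rows and columns kept in increasing order) of every order $1,2,\ldots,r$ are positive; the notion $TP_r$ is only used for $r\le \min\{m,n\}$. Dodgson condensation matrices: for $A=[a_{i,j}]$ an $n\times n$ real matrix put $D_0(A)=A$, i.e. $M^{(0)}_{i,j}=a_{i,j}$. Let $D_1(A)=[M^{(1)}_{i,j}]$ be the $(n-1)\times(n-1)$ matrix with $M^{(1)}_{i,j}=a_{i,j}a_{i+1,j+1}-a_{i,j+1}a_{i+1,j}$. For $2\leq k\leq n-1$, let $D_k(A)=[M^{(k)}_{i,j}]$ be the $(n-k)\times(n-k)$ matrix with $$M^{(k)}_{i,j}=\frac{M^{(k-1)}_{i,j}M^{(k-1)}_{i+1,j+1}-M^{(k-1)}_{i,j+1}M^{(k-1)}_{i+1,j}}{M^{(k-2)}_{i+1,j+1}},\qquad i,j=1,\ldots,n-k.$$ Equivalently (whenever the denominators are nonzero), $M^{(k)}_{i,j}$ is the contiguous minor of $A$ of order $k+1$ in rows $i,\ldots,i+k$ and columns $j,\ldots,j+k$. *)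

theory Defs
  imports
    "Jordan_Normal_Form.Determinant"
    "Jordan_Normal_Form.DL_Submatrix"
begin

text \<open>The order condition \<open>r \<le> min m n\<close> is part of the notion \<open>TP\<^sub>r\<close>; without it, the positivity
  condition on minors of too large an order would hold vacuously.\<close>

definition TP :: "nat \<Rightarrow> real mat \<Rightarrow> bool" where
  "TP r A \<longleftrightarrow> 1 \<le> r \<and> r \<le> min (dim_row A) (dim_col A) \<and>
     (\<forall>s I J. 1 \<le> s \<and> s \<le> r \<and>
        I \<subseteq> {0..<dim_row A} \<and> card I = s \<and> J \<subseteq> {0..<dim_col A} \<and> card J = s \<longrightarrow>
        det (submatrix A I J) > 0)"

text \<open>Matrix indices start at 0, so the entry \<open>(i, j)\<close> of \<open>dodgson k A\<close> is \<open>M\<^sup>(\<^sup>k\<^sup>)\<close> at position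
  \<open>(i + 1, j + 1)\<close>. The definition is meant for square \<open>A\<close> of size \<open>n > k\<close>; as usual, division by a zero
  interior entry gives 0.\<close>

fun dodgson :: "nat \<Rightarrow> real mat \<Rightarrow> real mat" where
  "dodgson 0 A = A"
| "dodgson (Suc 0) A = mat (dim_row A - 1) (dim_col A - 1) (\<lambda>(i, j).
     A $$ (i, j) * A $$ (i + 1, j + 1) - A $$ (i, j + 1) * A $$ (i + 1, j))"
| "dodgson (Suc (Suc k)) A = mat (dim_row A - (k + 2)) (dim_col A - (k + 2)) (\<lambda>(i, j).
     (dodgson (Suc k) A $$ (i, j) * dodgson (Suc k) A $$ (i + 1, j + 1)
      - dodgson (Suc k) A $$ (i, j + 1) * dodgson (Suc k) A $$ (i + 1, j))
     / dodgson k A $$ (i + 1, j + 1))"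

end

theory Submission
  imports Defs
begin

text \<open>The entries of \<open>D\<^sub>k(A)\<close> are contiguous minors of \<open>A\<close>, by the Desnanot--Jacobi identity. Writing
  \<open>C\<^sub>s(i,j)\<close> for the contiguous minor of order \<open>s\<close>, the same identity says that the contiguous \<open>2 \<times> 2\<close>
  minors of \<open>D\<^sub>k(A)\<close> are \<open>C\<^bsub>k+2\<^esub>(i,j) C\<^sub>k(i+1,j+1)\<close>, and (applied to a \<open>3 \<times> 3\<close> matrix) that a contiguous
  \<open>3 \<times> 3\<close> minor of \<open>D\<^sub>k(A)\<close> times its central entry is a difference of products of these. That difference
  is positive because \<open>C\<^bsub>k+2\<^esub>\<close> and \<open>C\<^sub>k\<close> both have positive contiguous \<open>2 \<times> 2\<close> minors. Finally,
  positivity of the contiguous minors up to order 3 spreads to all minors up to order 3 by Pluecker relations.\<close>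

section \<open>The Desnanot--Jacobi identity\<close>

lemma det_sparse_column:
  fixes A :: "'a :: comm_ring_1 mat"
  assumes A: "A \<in> carrier_mat n n" and j: "j < n" and k: "k < n"
    and zero: "\<And>i. i < n \<Longrightarrow> i \<noteq> k \<Longrightarrow> A $$ (i, j) = 0"
  shows "det A = A $$ (k, j) * cofactor A k j"
proof -
  have "det A = (\<Sum>i<n. A $$ (i, j) * cofactor A i j)"
    by (rule laplace_expansion_column[OF A j])
  also have "\<dots> = (\<Sum>i<n. if i = k then A $$ (k, j) * cofactor A k j else 0)"
    by (rule sum.cong) (auto simp: zero)
  also have "\<dots> = A $$ (k, j) * cofactor A k j"
    using k by simp
  finally show ?thesis .
qed

text \<open>Column 1 is a unit vector, so expanding along it deletes row and column 1 and leaves a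
  matrix of the same shape. The outer columns lose their entry at index 1, hence the induction over
  arbitrary \<open>a\<close> and \<open>b\<close>; what survives is the determinant of the four
  corners.\<close>

lemma det_bordered_identity:
  fixes a b :: "nat \<Rightarrow> 'a :: comm_ring_1"
  shows "det (mat (m + 2) (m + 2) (\<lambda>(i, j). if j = 0 then a i else if j = m + 1 then b i
           else if i = j then 1 else 0)) = a 0 * b (m + 1) - a (m + 1) * b 0"
proof (induction m arbitrary: a b)
  case 0
  let ?A = "mat (0 + 2) (0 + 2) (\<lambda>(i, j). if j = 0 then a i else if j = 0 + 1 then b i
           else if i = j then 1 else 0)"
  have "det ?A = (\<Sum>i<2. ?A $$ (i, 0) * cofactor ?A i 0)"
    by (rule laplace_expansion_column) auto
  also have "\<dots> = a 0 * b (0 + 1) - a (0 + 1) * b 0"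
    by (simp add: numeral_2_eq_2 cofactor_def mat_delete_def det_single)
  finally show ?case .
next
  case (Suc m)
  let ?A = "mat (Suc m + 2) (Suc m + 2) (\<lambda>(i, j). if j = 0 then a i else if j = Suc m + 1 then b i
           else if i = j then 1 else 0)"
  have "det ?A = ?A $$ (1, 1) * cofactor ?A 1 1"
    by (rule det_sparse_column) auto
  also have "\<dots> = det (mat_delete ?A 1 1)"
    by (simp add: cofactor_def)
  also have "mat_delete ?A 1 1 = mat (m + 2) (m + 2) (\<lambda>(i, j).
      if j = 0 then a (if i = 0 then 0 else i + 1)
      else if j = m + 1 then b (if i = 0 then 0 else i + 1) else if i = j then 1 else 0)"
    by (rule eq_matI) (auto simp: mat_delete_def)
  also have "det \<dots> = a 0 * b (Suc m + 1) - a (Suc m + 1) * b 0"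
    by (subst Suc.IH) simp
  finally show ?case .
qed

text \<open>Multiplying \<open>A\<close> by the identity matrix whose outer columns are replaced by those of the adjugate
  clears the outer columns of \<open>A\<close> up to a factor \<open>det A\<close> in the corners. This yields the identity
  times \<open>det A\<close>, whence the assumption that \<open>det A\<close> is nonzero.\<close>

lemma desnanot_jacobi:
  fixes A :: "'a :: idom mat"
  assumes A: "A \<in> carrier_mat (m + 2) (m + 2)" and nz: "det A \<noteq> 0"
  shows "det A * det (mat_delete (mat_delete A 0 0) m m)
    = det (mat_delete A 0 0) * det (mat_delete A (m + 1) (m + 1))
      - det (mat_delete A 0 (m + 1)) * det (mat_delete A (m + 1) 0)"
proof -
  let ?d = "det A" and ?l = "m + 1"
  define B where "B = mat (m + 2) (m + 2) (\<lambda>(i, j). if j = 0 then adj_mat A $$ (i, 0)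
      else if j = ?l then adj_mat A $$ (i, ?l) else if i = j then 1 else 0)"
  have B: "B \<in> carrier_mat (m + 2) (m + 2)" by (simp add: B_def)
  note adj = adj_mat[OF A]
  define P where "P = A * B"
  have P: "P \<in> carrier_mat (m + 2) (m + 2)" using A B by (simp add: P_def)
  have outer: "P $$ (i, j) = (if i = j then ?d else 0)" if "i < m + 2" "j = 0 \<or> j = ?l" for i j
  proof -
    have j: "j < m + 2" using that by auto
    have "col B j = col (adj_mat A) j"
      using that j adj(1) by (auto simp: B_def)
    then have "P $$ (i, j) = (A * adj_mat A) $$ (i, j)"
      using that(1) j A B adj(1) by (simp add: P_def)
    also have "\<dots> = (if i = j then ?d else 0)"
      using that(1) j by (simp add: adj(2))
    finally show ?thesis .
  qed
  have inner: "P $$ (i, j) = A $$ (i, j)" if "i < m + 2" "0 < j" "j < ?l" for i j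
  proof -
    have "col B j = unit_vec (m + 2) j"
      using that by (intro eq_vecI) (auto simp: B_def unit_vec_def)
    then show ?thesis
      using that A B by (simp add: P_def)
  qed
  \<comment> \<open>Each outer column of \<open>P\<close> has a single nonzero entry,
    \<open>?d\<close>, in its diagonal corner. Two expansions give \<open>?d\<close> squared times
    the central minor, where \<open>P\<close> agrees with \<open>A\<close>.\<close>
  have "det P = ?d * det (mat_delete P 0 0)"
    using det_sparse_column[OF P, of 0 0] by (simp add: outer cofactor_def)
  also have "det (mat_delete P 0 0) = ?d * det (mat_delete (mat_delete P 0 0) m m)"
    using det_sparse_column[of "mat_delete P 0 0" "m + 1" m m] P
    by (simp add: outer cofactor_def mat_delete_def)
  also have "mat_delete (mat_delete P 0 0) m m = mat_delete (mat_delete A 0 0) m m"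
    using A P by (intro eq_matI) (auto simp: mat_delete_def inner)
  finally have P1: "det P = ?d * (?d * det (mat_delete (mat_delete A 0 0) m m))" .
  have "det B = adj_mat A $$ (0, 0) * adj_mat A $$ (?l, ?l) - adj_mat A $$ (?l, 0) * adj_mat A $$ (0, ?l)"
    unfolding B_def by (rule det_bordered_identity)
  \<comment> \<open>The adjugate transposes the cofactors. The two off-diagonal corners both carry
    the sign (-1)^(m+1), which cancels in their product.\<close>
  also have "\<dots> = det (mat_delete A 0 0) * det (mat_delete A ?l ?l)
      - det (mat_delete A 0 ?l) * det (mat_delete A ?l 0)"
    using A by (auto simp: adj_mat_def cofactor_def power_add[symmetric] mult.assoc[symmetric] minus_one_power_iff)
  finally have "?d * (?d * det (mat_delete (mat_delete A 0 0) m m))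
      = ?d * (det (mat_delete A 0 0) * det (mat_delete A ?l ?l)
      - det (mat_delete A 0 ?l) * det (mat_delete A ?l 0))"
    using det_mult[OF A B] P1 by (metis P_def)
  then show ?thesis using nz by simp
qed

text \<open>As an index shift, a block that loses an outer row and an outer column is again a block.
  Order 0 gives determinant 1, so condensation with \<open>s = 0\<close> is the plain determinant of
  order 2.\<close>

definition contig :: "'a mat \<Rightarrow> nat \<Rightarrow> nat \<Rightarrow> nat \<Rightarrow> 'a mat" where
  "contig A s i j = mat s s (\<lambda>(p, q). A $$ (i + p, j + q))"

lemma condensation:
  fixes A :: "'a :: idom mat"
  assumes "det (contig A (s + 2) i j) \<noteq> 0"
  shows "det (contig A (s + 2) i j) * det (contig A s (i + 1) (j + 1))
    = det (contig A (s + 1) i j) * det (contig A (s + 1) (i + 1) (j + 1))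
      - det (contig A (s + 1) i (j + 1)) * det (contig A (s + 1) (i + 1) j)"
proof -
  let ?B = "contig A (s + 2) i j"
  have B: "?B \<in> carrier_mat (s + 2) (s + 2)" by (simp add: contig_def)
  have "mat_delete ?B 0 0 = contig A (s + 1) (i + 1) (j + 1)"
    "mat_delete ?B (s + 1) (s + 1) = contig A (s + 1) i j"
    "mat_delete ?B 0 (s + 1) = contig A (s + 1) (i + 1) j"
    "mat_delete ?B (s + 1) 0 = contig A (s + 1) i (j + 1)"
    "mat_delete (contig A (s + 1) (i + 1) (j + 1)) s s = contig A s (i + 1) (j + 1)"
    by (rule eq_matI; auto simp: mat_delete_def contig_def)+
  then show ?thesis
    using desnanot_jacobi[OF B assms] by (simp add: mult.commute)
qed

section \<open>Contiguous minors of \<open>TP\<^sub>r\<close> matrices and condensation\<close>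

lemma pick_interval:
  assumes "p < s"
  shows "pick {i..<i + s} p = i + p"
proof -
  have "{a \<in> {i..<i + s}. a < i + p} = {i..<i + p}" using assms by auto
  then show ?thesis
    using pick_card_in_set[of "i + p" "{i..<i + s}"] assms by simp
qed

lemma contig_eq_submatrix:
  assumes "i + s \<le> dim_row A" "j + s \<le> dim_col A"
  shows "contig A s i j = submatrix A {i..<i + s} {j..<j + s}"
proof -
  have "{p. p < dim_row A \<and> p \<in> {i..<i + s}} = {i..<i + s}"
    "{p. p < dim_col A \<and> p \<in> {j..<j + s}} = {j..<j + s}"
    using assms by auto
  then show ?thesis
    by (intro eq_matI) (simp_all add: contig_def submatrix_def pick_interval)
qed

lemma TP_contig_pos:
  assumes "TP r A" "s \<le> r" "i + s \<le> dim_row A" "j + s \<le> dim_col A"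
  shows "det (contig A s i j) > 0"
\<comment> \<open>\<open>TP\<close> speaks of orders from 1 on; the empty minor, equal to 1, occurs
  later as the central minor when \<open>k = 1\<close>.\<close>
proof (cases "s = 0")
  case True
  then show ?thesis by (simp add: contig_def)
next
  case False
  have "{i..<i + s} \<subseteq> {0..<dim_row A}" "{j..<j + s} \<subseteq> {0..<dim_col A}"
    using assms by auto
  then show ?thesis
    using assms False unfolding TP_def contig_eq_submatrix[OF assms(3,4)] by simp
qed

lemma dim_dodgson [simp]:
  "dim_row (dodgson k A) = dim_row A - k" "dim_col (dodgson k A) = dim_col A - k"
  by (induction k A rule: dodgson.induct) simp_all

lemma dodgson_eq_contig:
  assumes "TP r A" "k + 1 \<le> r" "i + k < dim_row A" "j + k < dim_col A"
  shows "dodgson k A $$ (i, j) = det (contig A (k + 1) i j)"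
  using assms
proof (induction k A arbitrary: i j rule: dodgson.induct)
  case (1 A)
  then show ?case by (simp add: contig_def det_single)
next
  case (2 A)
  have "det (contig A (0 + 2) i j) > 0"
    using 2 by (intro TP_contig_pos) auto
  then show ?case
    using 2 condensation[of A 0 i j] by (simp add: contig_def det_single)
next
  case (3 k A)
  \<comment> \<open>The first minor meets the nonvanishing hypothesis of
    \<open>condensation\<close>; the second is the denominator in the recursion.\<close>
  have pos: "det (contig A (k + 1 + 2) i j) > 0" "det (contig A (k + 1) (i + 1) (j + 1)) > 0"
    using 3 by (auto intro!: TP_contig_pos)
  then show ?case
    using 3 condensation[of A "k + 1" i j] by (simp add: field_simps)
qed

section \<open>Total positivity of order 2 and 3 from contiguous minors\<close>

text \<open>With explicit polynomials, the Pluecker relations are checked by ring normalisation and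
  transposition only swaps the index groups.\<close>

definition minor2 :: "(nat \<Rightarrow> nat \<Rightarrow> 'a :: comm_ring_1) \<Rightarrow> nat \<Rightarrow> nat \<Rightarrow> nat \<Rightarrow> nat \<Rightarrow> 'a" where
  "minor2 f a b p q = f a p * f b q - f a q * f b p"

definition minor3 :: "(nat \<Rightarrow> nat \<Rightarrow> 'a :: comm_ring_1) \<Rightarrow>
    nat \<Rightarrow> nat \<Rightarrow> nat \<Rightarrow> nat \<Rightarrow> nat \<Rightarrow> nat \<Rightarrow> 'a" where
  "minor3 f a b c p q r =
     f a p * minor2 f b c q r - f a q * minor2 f b c p r + f a r * minor2 f b c p q"

lemma minor2_flip: "minor2 (\<lambda>i j. f j i) a b p q = minor2 f p q a b"
  by (simp add: minor2_def algebra_simps)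

lemma minor3_flip: "minor3 (\<lambda>i j. f j i) a b c p q r = minor3 f p q r a b c"
  by (simp add: minor3_def minor2_def algebra_simps)

text \<open>Positivity says that the ratio \<open>f b j / f a j\<close> increases strictly with
  \<open>j\<close>, so neighbouring columns suffice. The three-term relation in the proof is
  transitivity with denominators cleared.\<close>

lemma minor2_pos_columns:
  fixes f :: "nat \<Rightarrow> nat \<Rightarrow> 'a :: linordered_field"
  assumes entry: "\<And>j. j < n \<Longrightarrow> f a j > 0"
    and adj: "\<And>j. j + 1 < n \<Longrightarrow> minor2 f a b j (j + 1) > 0"
    and "p < q" "q < n"
  shows "minor2 f a b p q > 0"
  using \<open>p < q\<close> \<open>q < n\<close>
proof (induction q rule: less_Suc_induct[case_names adj trans, consumes 1])
  case (adj i)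
  then show ?case using assms(2) by simp
next
  case (trans i j k)
  then have "f a k * minor2 f a b i j + f a i * minor2 f a b j k > 0"
    by (intro add_pos_pos mult_pos_pos entry) auto
  also have "f a k * minor2 f a b i j + f a i * minor2 f a b j k = f a j * minor2 f a b i k"
    by (simp add: minor2_def algebra_simps)
  finally show ?case
    using entry[of j] trans by (simp add: zero_less_mult_iff)
qed

text \<open>First columns spread for each pair of neighbouring rows; then rows spread by the same
  argument on the transpose.\<close>

lemma minor2_pos:
  fixes f :: "nat \<Rightarrow> nat \<Rightarrow> 'a :: linordered_field"
  assumes entry: "\<And>i j. i < m \<Longrightarrow> j < n \<Longrightarrow> f i j > 0"
    and adj: "\<And>i j. i + 1 < m \<Longrightarrow> j + 1 < n \<Longrightarrow> minor2 f i (i + 1) j (j + 1) > 0"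
    and "a < b" "b < m" "p < q" "q < n"
  shows "minor2 f a b p q > 0"
proof -
  have rows: "minor2 f i (i + 1) p q > 0" if "i + 1 < m" for i
    by (rule minor2_pos_columns[where n = n]) (use that assms in auto)
  have "minor2 (\<lambda>i j. f j i) p q a b > 0"
    by (rule minor2_pos_columns[where n = m]) (use assms rows in \<open>auto simp: minor2_flip[of f]\<close>)
  then show ?thesis by (simp add: minor2_flip[of f])
qed

text \<open>Both inductions use the three-term relation bordered by one column that occurs in all
  its minors: those of order 2 in rows \<open>a\<close>, \<open>b\<close> and those of order 3 in
  rows \<open>a\<close>, \<open>b\<close>, \<open>c\<close>.\<close>

lemma minor3_pos_columns:
  fixes f :: "nat \<Rightarrow> nat \<Rightarrow> 'a :: linordered_field"
  assumes m2: "\<And>p q. p < q \<Longrightarrow> q < n \<Longrightarrow> minor2 f a b p q > 0"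
    and adj: "\<And>j. j + 2 < n \<Longrightarrow> minor3 f a b c j (j + 1) (j + 2) > 0"
    and "p < q" "q < r" "r < n"
  shows "minor3 f a b c p q r > 0"
proof -
  let ?D = "minor2 f a b" and ?T = "minor3 f a b c"
  \<comment> \<open>The last two columns stay adjacent while the gap before them grows; the common
    column of the relation is \<open>y + 1\<close>.\<close>
  have last: "?T x y (y + 1) > 0" if "x < y" "y + 1 < n" for x y
    using that(1)[THEN Suc_leI] that(2)
  proof (induction y rule: dec_induct)
    case base
    then show ?case using adj[of x] by simp
  next
    case (step y)
    have "?D x (y + 1) * ?T y (y + 1) (y + 2) + ?D (y + 1) (y + 2) * ?T x y (y + 1) > 0"
      using step by (intro add_pos_pos mult_pos_pos m2 adj) auto
    also have "?D x (y + 1) * ?T y (y + 1) (y + 2) + ?D (y + 1) (y + 2) * ?T x y (y + 1)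
        = ?D y (y + 1) * ?T x (y + 1) (y + 2)"
      by (simp add: minor3_def minor2_def algebra_simps)
    finally show ?case
      using m2[of y "y + 1"] step by (simp add: zero_less_mult_iff)
  qed
  \<comment> \<open>Now the last column moves away, with common column \<open>q\<close>.\<close>
  show ?thesis
    using \<open>q < r\<close>[THEN Suc_leI] \<open>r < n\<close>
  proof (induction r rule: dec_induct)
    case base
    then show ?case using last[of p q] \<open>p < q\<close> by simp
  next
    case (step r)
    have "?D q (r + 1) * ?T p q r + ?D p q * ?T q r (r + 1) > 0"
      using step \<open>p < q\<close> by (intro add_pos_pos mult_pos_pos m2 last) auto
    also have "?D q (r + 1) * ?T p q r + ?D p q * ?T q r (r + 1) = ?D q r * ?T p q (r + 1)"
      by (simp add: minor3_def minor2_def algebra_simps)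
    finally show ?case
      using m2[of q r] step by (simp add: zero_less_mult_iff)
  qed
qed

text \<open>The pass over rows works on the transpose with the possibly distant columns
  \<open>p\<close>, \<open>q\<close>, \<open>r\<close> fixed, so it calls for minors of order 2 in
  arbitrary columns.\<close>

lemma minor3_pos:
  fixes f :: "nat \<Rightarrow> nat \<Rightarrow> 'a :: linordered_field"
  assumes m2: "\<And>a b p q. a < b \<Longrightarrow> b < m \<Longrightarrow> p < q \<Longrightarrow> q < n \<Longrightarrow> minor2 f a b p q > 0"
    and adj: "\<And>i j. i + 2 < m \<Longrightarrow> j + 2 < n \<Longrightarrow>
      minor3 f i (i + 1) (i + 2) j (j + 1) (j + 2) > 0"
    and "a < b" "b < c" "c < m" "p < q" "q < r" "r < n"
  shows "minor3 f a b c p q r > 0"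
proof -
  have rows: "minor3 f i (i + 1) (i + 2) p q r > 0" if "i + 2 < m" for i
    by (rule minor3_pos_columns[where n = n]) (use that assms in auto)
  have "minor3 (\<lambda>i j. f j i) p q r a b c > 0"
    by (rule minor3_pos_columns[where n = m])
      (use assms rows in \<open>auto simp: minor2_flip[of f] minor3_flip[of f]\<close>)
  then show ?thesis by (simp add: minor3_flip[of f])
qed

section \<open>Criteria for total positivity of order 2 and 3\<close>

lemma det_2_eq_minor2:
  assumes "A \<in> carrier_mat 2 2"
  shows "det A = minor2 (\<lambda>i j. A $$ (i, j)) 0 1 0 1"
  using assms laplace_expansion_row[OF assms, of 0]
  by (simp add: numeral_2_eq_2 cofactor_def det_single minor2_def mat_delete_def)

lemma det_3_eq_minor3:
  assumes "A \<in> carrier_mat 3 3"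
  shows "det A = minor3 (\<lambda>i j. A $$ (i, j)) 0 1 2 0 1 2"
proof -
  have "det (mat_delete A 0 j) = minor2 (\<lambda>i j. A $$ (i, j)) 1 2 (if j = 0 then 1 else 0) (if j < 2 then 2 else 1)"
    if "j < 3" for j
    using assms that
    by (subst det_2_eq_minor2) (auto simp: mat_delete_def minor2_def numeral_2_eq_2)
  moreover have "det A = (\<Sum>j<3. A $$ (0, j) * cofactor A 0 j)"
    by (rule laplace_expansion_row[OF assms]) simp
  moreover have "{..<3} = {0, 1, 2 :: nat}" by auto
  ultimately show ?thesis
    by (simp add: cofactor_def minor3_def)
qed

text \<open>Replaces index sets by their increasing enumerations, given by \<open>pick\<close>, so
  that minors can be treated by index arithmetic.\<close>

lemma TP_I:
  assumes "1 \<le> r" "r \<le> min (dim_row A) (dim_col A)"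
    and minors: "\<And>s a b. 1 \<le> s \<Longrightarrow> s \<le> r \<Longrightarrow>
      (\<And>i j. i < j \<Longrightarrow> j < s \<Longrightarrow> a i < a j \<and> b i < b j) \<Longrightarrow>
      (\<And>i. i < s \<Longrightarrow> a i < dim_row A \<and> b i < dim_col A) \<Longrightarrow>
      det (mat s s (\<lambda>(i, j). A $$ (a i, b j))) > 0"
  shows "TP r A"
  unfolding TP_def
proof (intro conjI allI impI assms(1,2), elim conjE)
  fix s I J
  assume s: "1 \<le> s" "s \<le> r" and IJ: "I \<subseteq> {0..<dim_row A}" "card I = s" "J \<subseteq> {0..<dim_col A}" "card J = s"
  have "{i. i < dim_row A \<and> i \<in> I} = I" "{j. j < dim_col A \<and> j \<in> J} = J"
    using IJ by auto
  then have "submatrix A I J = mat s s (\<lambda>(i, j). A $$ (pick I i, pick J j))"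
    using IJ by (simp add: submatrix_def)
  moreover have "pick I i < pick I j \<and> pick J i < pick J j" if "i < j" "j < s" for i j
    using that IJ by (simp add: pick_mono_le)
  moreover have "pick I i < dim_row A \<and> pick J i < dim_col A" if "i < s" for i
    using that IJ pick_in_set_le[of i I] pick_in_set_le[of i J] by auto
  ultimately show "det (submatrix A I J) > 0"
    using minors[OF s] by simp
qed

lemma TP_2_I:
  assumes "2 \<le> min (dim_row A) (dim_col A)"
    and "\<And>i j. i < dim_row A \<Longrightarrow> j < dim_col A \<Longrightarrow> A $$ (i, j) > 0"
    and "\<And>i j. i + 1 < dim_row A \<Longrightarrow> j + 1 < dim_col A \<Longrightarrow>
      minor2 (\<lambda>i j. A $$ (i, j)) i (i + 1) j (j + 1) > 0"
  shows "TP 2 A"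
proof (rule TP_I)
  fix s :: nat and a b :: "nat \<Rightarrow> nat"
  assume s: "1 \<le> s" "s \<le> 2"
    and mono: "\<And>i j. i < j \<Longrightarrow> j < s \<Longrightarrow> a i < a j \<and> b i < b j"
    and bound: "\<And>i. i < s \<Longrightarrow> a i < dim_row A \<and> b i < dim_col A"
  consider "s = 1" | "s = 2" using s by linarith
  then show "det (mat s s (\<lambda>(i, j). A $$ (a i, b j))) > 0"
  proof cases
    case 1
    then show ?thesis using bound[of 0] assms(2) by (simp add: det_single)
  next
    case 2
    have "minor2 (\<lambda>i j. A $$ (i, j)) (a 0) (a 1) (b 0) (b 1) > 0"
      by (rule minor2_pos[where m = "dim_row A" and n = "dim_col A"])
        (use 2 mono[of 0 1] bound[of 1] assms(2,3) in auto)
    then show ?thesis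
      using 2 by (simp add: det_2_eq_minor2 minor2_def)
  qed
qed (use assms in auto)

lemma TP_3_I:
  assumes "3 \<le> min (dim_row A) (dim_col A)"
    and "\<And>i j. i < dim_row A \<Longrightarrow> j < dim_col A \<Longrightarrow> A $$ (i, j) > 0"
    and "\<And>i j. i + 1 < dim_row A \<Longrightarrow> j + 1 < dim_col A \<Longrightarrow>
      minor2 (\<lambda>i j. A $$ (i, j)) i (i + 1) j (j + 1) > 0"
    and "\<And>i j. i + 2 < dim_row A \<Longrightarrow> j + 2 < dim_col A \<Longrightarrow>
      minor3 (\<lambda>i j. A $$ (i, j)) i (i + 1) (i + 2) j (j + 1) (j + 2) > 0"
  shows "TP 3 A"
proof (rule TP_I)
  fix s :: nat and a b :: "nat \<Rightarrow> nat"
  assume s: "1 \<le> s" "s \<le> 3"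
    and mono: "\<And>i j. i < j \<Longrightarrow> j < s \<Longrightarrow> a i < a j \<and> b i < b j"
    and bound: "\<And>i. i < s \<Longrightarrow> a i < dim_row A \<and> b i < dim_col A"
  have m2: "minor2 (\<lambda>i j. A $$ (i, j)) i i' j j' > 0"
    if "i < i'" "i' < dim_row A" "j < j'" "j' < dim_col A" for i i' j j'
    by (rule minor2_pos[where m = "dim_row A" and n = "dim_col A"]) (use that assms(2,3) in auto)
  consider "s = 1" | "s = 2" | "s = 3" using s by linarith
  then show "det (mat s s (\<lambda>(i, j). A $$ (a i, b j))) > 0"
  proof cases
    case 1
    then show ?thesis using bound[of 0] assms(2) by (simp add: det_single)
  next
    case 2
    then show ?thesis
      using mono[of 0 1] bound[of 1] m2[of "a 0" "a 1" "b 0" "b 1"]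
      by (simp add: det_2_eq_minor2 minor2_def)
  next
    case 3
    have "minor3 (\<lambda>i j. A $$ (i, j)) (a 0) (a 1) (a 2) (b 0) (b 1) (b 2) > 0"
      by (rule minor3_pos[where m = "dim_row A" and n = "dim_col A"])
        (use 3 mono[of 0 1] mono[of 1 2] bound[of 2] m2 assms(4) in auto)
    then show ?thesis
      using 3 by (simp add: det_3_eq_minor3 minor3_def minor2_def)
  qed
qed (use assms in auto)

section \<open>Minors of order 2 and 3 of the condensation matrix\<close>

lemma minor2_dodgson:
  assumes "TP r A" "k + 2 \<le> r" "i + k + 1 < dim_row A" "j + k + 1 < dim_col A"
  shows "minor2 (\<lambda>i j. dodgson k A $$ (i, j)) i (i + 1) j (j + 1)
    = det (contig A (k + 2) i j) * det (contig A k (i + 1) (j + 1))"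
proof -
  have "det (contig A (k + 2) i j) > 0"
    using assms by (intro TP_contig_pos) auto
  then show ?thesis
    using assms condensation[of A k i j] by (simp add: minor2_def dodgson_eq_contig)
qed

text \<open>The difference of the two sides is a product of positive minors of orders
  \<open>s + 2\<close> and \<open>s\<close>, by condensation. Hence the array of contiguous minors
  of order \<open>s + 1\<close> itself has positive contiguous minors of order 2.\<close>

lemma contig_log_supermodular:
  assumes "TP r A" "s + 2 \<le> r" "i + s + 2 \<le> dim_row A" "j + s + 2 \<le> dim_col A"
  shows "det (contig A (s + 1) i (j + 1)) * det (contig A (s + 1) (i + 1) j)
    < det (contig A (s + 1) i j) * det (contig A (s + 1) (i + 1) (j + 1))"
proof -
  have "det (contig A (s + 2) i j) > 0" "det (contig A s (i + 1) (j + 1)) > 0"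
    using assms by (auto intro!: TP_contig_pos)
  then show ?thesis
    using condensation[of A s i j] mult_pos_pos by fastforce
qed

lemma minor3_dodgson_pos:
  assumes TP: "TP (k + 3) A" and k: "k \<ge> 1"
    and dims: "i + k + 2 < dim_row A" "j + k + 2 < dim_col A"
  shows "minor3 (\<lambda>i j. dodgson k A $$ (i, j)) i (i + 1) (i + 2) j (j + 1) (j + 2) > 0"
proof -
  define f where "f = (\<lambda>i j. dodgson k A $$ (i, j))"
  define C where "C = (\<lambda>s i j. det (contig A s i j))"
  \<comment> \<open>The bounds keep every block inside the window of \<open>k + 3\<close>
    consecutive rows and columns that starts at \<open>(i, j)\<close>.\<close>
  have pos: "C s (i + u) (j + v) > 0" if "s \<le> k + 3" "u + s \<le> k + 3" "v + s \<le> k + 3" for s u v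
    unfolding C_def using that dims by (intro TP_contig_pos[OF TP]) auto
  \<comment> \<open>This is where the positive minor of order \<open>k + 3\<close> enters.\<close>
  have big: "C (k + 2) i (j + 1) * C (k + 2) (i + 1) j < C (k + 2) i j * C (k + 2) (i + 1) (j + 1)"
    using contig_log_supermodular[OF TP, of "k + 1" i j] dims by (simp add: C_def)
  \<comment> \<open>Here \<open>k >= 1\<close> ensures that \<open>k - 1\<close> is a true
    predecessor; for \<open>k = 1\<close> the minors compared are entries of
    \<open>A\<close>.\<close>
  have small: "C k (i + 1) (j + 2) * C k (i + 2) (j + 1) < C k (i + 1) (j + 1) * C k (i + 2) (j + 2)"
    using contig_log_supermodular[OF TP, of "k - 1" "i + 1" "j + 1"] dims k by (simp add: C_def)
  have "(C (k + 2) i (j + 1) * C (k + 2) (i + 1) j) * (C k (i + 1) (j + 2) * C k (i + 2) (j + 1))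
      < (C (k + 2) i j * C (k + 2) (i + 1) (j + 1)) * (C k (i + 1) (j + 1) * C k (i + 2) (j + 2))"
    using pos[of "k + 2" 0 1] pos[of "k + 2" 1 0] pos[of k 1 2] pos[of k 2 1]
    by (intro mult_strict_mono' big small) auto
  also have "(C (k + 2) i (j + 1) * C (k + 2) (i + 1) j) * (C k (i + 1) (j + 2) * C k (i + 2) (j + 1))
      = minor2 f i (i + 1) (j + 1) (j + 2) * minor2 f (i + 1) (i + 2) j (j + 1)"
    using minor2_dodgson[OF TP, of k i "j + 1"] minor2_dodgson[OF TP, of k "i + 1" j] dims
    by (simp add: f_def C_def)
  also have "(C (k + 2) i j * C (k + 2) (i + 1) (j + 1)) * (C k (i + 1) (j + 1) * C k (i + 2) (j + 2))
      = minor2 f i (i + 1) j (j + 1) * minor2 f (i + 1) (i + 2) (j + 1) (j + 2)"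
    using minor2_dodgson[OF TP, of k i j] minor2_dodgson[OF TP, of k "i + 1" "j + 1"] dims
    by (simp add: f_def C_def)
  \<comment> \<open>The identity for order 3 is obtained by expansion, since
    \<open>desnanot_jacobi\<close> presupposes a nonzero determinant, and the sign of this very
    determinant is sought.\<close>
  finally have "0 < f (i + 1) (j + 1) * minor3 f i (i + 1) (i + 2) j (j + 1) (j + 2)"
    by (simp add: minor3_def minor2_def algebra_simps)
  moreover have "f (i + 1) (j + 1) > 0"
    using pos[of "k + 1" 1 1] dims by (simp add: f_def C_def dodgson_eq_contig[OF TP])
  ultimately show ?thesis
    by (simp add: f_def zero_less_mult_iff)
qed

theorem theorem2:
  fixes A :: "real mat" and n k :: nat
  assumes "A \<in> carrier_mat n n"
    and "k \<ge> 1"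
  shows "(k + 2 \<le> n \<and> TP (k + 2) A \<longrightarrow> TP 2 (dodgson k A)) \<and>
         (k + 3 \<le> n \<and> TP (k + 3) A \<longrightarrow> TP 3 (dodgson k A))"
proof -
  have dims: "dim_row A = n" "dim_col A = n" using assms by auto
  \<comment> \<open>The order \<open>r\<close> stays free so that the same facts serve both
    \<open>k + 2\<close> and \<open>k + 3\<close>.\<close>
  have entry: "dodgson k A $$ (i, j) > 0"
    if "TP r A" "k + 2 \<le> r" "i < n - k" "j < n - k" for i j r
    using that dims TP_contig_pos[of r A "k + 1" i j] by (simp add: dodgson_eq_contig)
  have m2: "minor2 (\<lambda>i j. dodgson k A $$ (i, j)) i (i + 1) j (j + 1) > 0"
    if "TP r A" "k + 2 \<le> r" "i + 1 < n - k" "j + 1 < n - k" for i j r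
    using that dims TP_contig_pos[of r A "k + 2" i j] TP_contig_pos[of r A k "i + 1" "j + 1"]
    by (subst minor2_dodgson[of r]) auto
  show ?thesis
  proof (intro conjI impI; elim conjE)
    assume "k + 2 \<le> n" "TP (k + 2) A"
    then show "TP 2 (dodgson k A)"
      using dims by (intro TP_2_I) (auto intro: entry m2[simplified])
  next
    assume "k + 3 \<le> n" "TP (k + 3) A"
    then show "TP 3 (dodgson k A)"
      using dims assms(2) minor3_dodgson_pos[of k A]
      by (intro TP_3_I) (auto intro: entry m2[simplified])
  qed
qed

end
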